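(* Let $\mathcal M=(M,<,+,0,\ldots)$ be a DCULOAS structure. Let $C\subseteq M^m$ be a definable closed and bounded set and let $s\in M$, $s>0$. Then every pointwise convergent definable family of equi-continuous functions $\{f_t:C\rightarrow M\}_{0<t<s}$ is uniformly convergent.
   Context: "Definable" means definable in $\mathcal M$ with parameters. A DCULOAS structure is a definably complete uniformly locally o-minimal expansion of the second kind of a densely linearly ordered abelian group $(M,<,+,0)$. Here: $\mathcal M$ is definably complete if every definable subset of $M$ has a supremum and an infimum in $M\cup\{\pm\infty\}$; $\mathcal M$ is uniformly locally o-minimal of the second kind if for every definable $X\subseteq M^{n+1}$, every $a\in M$ and every $b\in M^n$ there exist an open interval $I\ni a$ and an open box $B\ni b$ such that for every $y\in B$ the set $\{x\in M: (y,x)\in X\}\cap I$ is a finite union of points and open intervals. $M^n$ carries the product of the order topology; for $x\in M^n$, $|x|=\max_i|x_i|$. A family $\{f_t:C\to M\}_{0<t<s}$ is a definable family of functions if $F(x,t)=f_t(x)$ is a definable function on $C\times]0,s[$. It is a family of equi-continuous functions if $\forall\varepsilon>0\,\forall x\in C\,\exists\delta>0\,\forall t\in]0,s[\,\forall x'\in C$, $|x-x'|<\delta\Rightarrow|F(x,t)-F(x',t)|<\varepsilon$. It is pointwise convergent if for all $\varepsilon>0$ and $x\in C$ there is $s'>0$ with $|f_t(x)-f_{t'}(x)|<\varepsilon$ for all $t,t'\in]0,s'[$. It is uniformly convergent if for all $\varepsilon>0$ there is $s'>0$ with $|f_t(x)-f_{t'}(x)|<\varepsilon$ for all $x\in C$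 and all $t,t'\in]0,s'[$. *)

theory Defs
  imports "HOL-Analysis.Function_Topology" "HOL-Library.Extended" "HOL-Library.Lub_Glb"
begin

text \<open>
  Densely linearly ordered abelian groups with the order topology. The group and the order determine
  the other operations: \<open>\<bar>a\<bar>\<close> is the maximum of \<open>a\<close> and \<open>- a\<close>, and \<open>open\<close> is the order topology.
\<close>

class dense_ordered_group =
  linordered_ab_group_add + ordered_ab_group_add_abs + dense_linorder + linorder_topology

text \<open>
  First-order formulas over a language that extends \<open>{<, +, 0}\<close> by function symbols \<open>'f\<close> and
  relation symbols \<open>'r\<close>. Symbols carry no arity: \<open>f\<close> applied to \<open>k\<close> arguments plays the role of a
  \<open>k\<close>-ary symbol, so that a language with arities is covered by giving a symbol a trivial
  interpretation at the other arities.
\<close>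

datatype 'f trm = Var nat | Zero | Plus "'f trm" "'f trm" | Fun 'f "'f trm list"

datatype ('f, 'r) fm =
    Equal "'f trm" "'f trm"
  | Less "'f trm" "'f trm"
  | Rel 'r "'f trm list"
  | Neg "('f, 'r) fm"
  | Conj "('f, 'r) fm" "('f, 'r) fm"
  | Exi nat "('f, 'r) fm"

text \<open>
  An expansion of \<open>(M, <, +, 0)\<close>, where \<open>M\<close> is the type \<open>'a\<close>.
\<close>

record ('a, 'f, 'r) expansion =
  fun_interp :: "'f \<Rightarrow> 'a list \<Rightarrow> 'a"
  rel_interp :: "'r \<Rightarrow> 'a list \<Rightarrow> bool"

primrec trm_val ::
  "('a::dense_ordered_group, 'f, 'r) expansion \<Rightarrow> (nat \<Rightarrow> 'a) \<Rightarrow> 'f trm \<Rightarrow> 'a" where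
  "trm_val \<M> e (Var i) = e i"
| "trm_val \<M> e Zero = 0"
| "trm_val \<M> e (Plus t u) = trm_val \<M> e t + trm_val \<M> e u"
| "trm_val \<M> e (Fun f ts) = fun_interp \<M> f (map (trm_val \<M> e) ts)"

primrec sat ::
  "('a::dense_ordered_group, 'f, 'r) expansion \<Rightarrow> (nat \<Rightarrow> 'a) \<Rightarrow> ('f, 'r) fm \<Rightarrow> bool" where
  "sat \<M> e (Equal t u) \<longleftrightarrow> trm_val \<M> e t = trm_val \<M> e u"
| "sat \<M> e (Less t u) \<longleftrightarrow> trm_val \<M> e t < trm_val \<M> e u"
| "sat \<M> e (Rel r ts) \<longleftrightarrow> rel_interp \<M> r (map (trm_val \<M> e) ts)"
| "sat \<M> e (Neg \<phi>) \<longleftrightarrow> \<not> sat \<M> e \<phi>"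
| "sat \<M> e (Conj \<phi> \<psi>) \<longleftrightarrow> sat \<M> e \<phi> \<and> sat \<M> e \<psi>"
| "sat \<M> e (Exi i \<phi>) \<longleftrightarrow> (\<exists>a. sat \<M> (e(i := a)) \<phi>)"

text \<open>
  A point of \<open>M^n\<close> is an extensional function on \<open>{..<n}\<close>, the carrier of the library's product
  topology; \<open>y(n := x)\<close> is the point \<open>(y, x)\<close> of \<open>M^(n+1)\<close>.
\<close>

abbreviation cart_power :: "nat \<Rightarrow> (nat \<Rightarrow> 'a) set" where
  "cart_power n \<equiv> {..<n} \<rightarrow>\<^sub>E UNIV"

text \<open>
  Definability with parameters: the variables below \<open>n\<close> are the coordinates, the remaining ones take
  their values from \<open>p\<close> and serve as parameters.
\<close>

definition definable ::
  "('a::dense_ordered_group, 'f, 'r) expansion \<Rightarrow> nat \<Rightarrow> (nat \<Rightarrow> 'a) set \<Rightarrow> bool" where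
  "definable \<M> n X \<longleftrightarrow>
    (\<exists>\<phi> p. X = {x \<in> cart_power n. sat \<M> (\<lambda>i. if i < n then x i else p i) \<phi>})"

definition definably_complete :: "('a::dense_ordered_group, 'f, 'r) expansion \<Rightarrow> bool" where
  "definably_complete \<M> \<longleftrightarrow>
    (\<forall>A. definable \<M> 1 {x \<in> cart_power 1. x 0 \<in> A} \<longrightarrow>
      (\<exists>u. isLub UNIV (Fin ` A) u) \<and> (\<exists>l. isGlb UNIV (Fin ` A) l))"

definition open_interval :: "'a::dense_ordered_group set \<Rightarrow> bool" where
  "open_interval I \<longleftrightarrow> (\<exists>l u. I = {x. l < Fin x \<and> Fin x < u})"

definition open_box :: "nat \<Rightarrow> (nat \<Rightarrow> 'a::dense_ordered_group) set \<Rightarrow> bool" where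
  "open_box n B \<longleftrightarrow> (\<exists>I. (\<forall>i<n. open_interval (I i)) \<and> B = (\<Pi>\<^sub>E i\<in>{..<n}. I i))"

definition finite_union_points_intervals :: "'a::dense_ordered_group set \<Rightarrow> bool" where
  "finite_union_points_intervals A \<longleftrightarrow>
    (\<exists>\<J>. finite \<J> \<and> (\<forall>J\<in>\<J>. (\<exists>c. J = {c}) \<or> open_interval J) \<and> A = \<Union>\<J>)"

definition uniformly_locally_o_minimal_2nd ::
  "('a::dense_ordered_group, 'f, 'r) expansion \<Rightarrow> bool" where
  "uniformly_locally_o_minimal_2nd \<M> \<longleftrightarrow>
    (\<forall>n X. definable \<M> (Suc n) X \<longrightarrow>
      (\<forall>a. \<forall>b\<in>cart_power n. \<exists>I B.
        open_interval I \<and> a \<in> I \<and> open_box n B \<and> b \<in> B \<and>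
        (\<forall>y\<in>B. finite_union_points_intervals ({x. y(n := x) \<in> X} \<inter> I))))"

definition DCULOAS :: "('a::dense_ordered_group, 'f, 'r) expansion \<Rightarrow> bool" where
  "DCULOAS \<M> \<longleftrightarrow> definably_complete \<M> \<and> uniformly_locally_o_minimal_2nd \<M>"

text \<open>
  Inserting \<open>0\<close> changes nothing for \<open>n \<ge> 1\<close> and sets the norm of the only point of \<open>M^0\<close> to \<open>0\<close>.
\<close>

definition max_norm :: "nat \<Rightarrow> (nat \<Rightarrow> 'a::dense_ordered_group) \<Rightarrow> 'a" where
  "max_norm n x = Max (insert 0 ((\<lambda>i. \<bar>x i\<bar>) ` {..<n}))"

definition closed_set :: "nat \<Rightarrow> (nat \<Rightarrow> 'a::dense_ordered_group) set \<Rightarrow> bool" where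
  "closed_set n C \<longleftrightarrow> closedin (product_topology (\<lambda>_. euclidean) {..<n}) C"

definition bounded_set :: "nat \<Rightarrow> (nat \<Rightarrow> 'a::dense_ordered_group) set \<Rightarrow> bool" where
  "bounded_set n C \<longleftrightarrow> (\<exists>r. \<forall>x\<in>C. max_norm n x \<le> r)"

text \<open>
  A family \<open>f_t : C \<rightarrow> M\<close>, \<open>0 < t < s\<close>, is given by \<open>f t x\<close>; only the values with \<open>x \<in> C\<close> and
  \<open>0 < t < s\<close> matter. It is definable if the graph of \<open>(x, t) \<mapsto> f t x\<close> on \<open>C \<times> ]0,s[\<close> is definable.
\<close>

definition definable_family ::
  "('a::dense_ordered_group, 'f, 'r) expansion \<Rightarrow> nat \<Rightarrow> (nat \<Rightarrow> 'a) set \<Rightarrow> 'a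
    \<Rightarrow> ('a \<Rightarrow> (nat \<Rightarrow> 'a) \<Rightarrow> 'a) \<Rightarrow> bool" where
  "definable_family \<M> m C s f \<longleftrightarrow>
    definable \<M> (m + 2) {x(m := t, m + 1 := f t x) |x t. x \<in> C \<and> t \<in> {0<..<s}}"

definition equicontinuous_family ::
  "nat \<Rightarrow> (nat \<Rightarrow> 'a::dense_ordered_group) set \<Rightarrow> 'a \<Rightarrow> ('a \<Rightarrow> (nat \<Rightarrow> 'a) \<Rightarrow> 'a) \<Rightarrow> bool" where
  "equicontinuous_family m C s f \<longleftrightarrow>
    (\<forall>\<epsilon>>0. \<forall>x\<in>C. \<exists>\<delta>>0. \<forall>t\<in>{0<..<s}. \<forall>x'\<in>C.
      max_norm m (\<lambda>i. x i - x' i) < \<delta> \<longrightarrow> \<bar>f t x - f t x'\<bar> < \<epsilon>)"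

text \<open>
  The bound \<open>s' \<le> s\<close> below keeps \<open>t\<close> and \<open>t'\<close> in the index set of the family.
\<close>

definition pointwise_convergent_family ::
  "(nat \<Rightarrow> 'a::dense_ordered_group) set \<Rightarrow> 'a \<Rightarrow> ('a \<Rightarrow> (nat \<Rightarrow> 'a) \<Rightarrow> 'a) \<Rightarrow> bool" where
  "pointwise_convergent_family C s f \<longleftrightarrow>
    (\<forall>\<epsilon>>0. \<forall>x\<in>C. \<exists>s'>0. s' \<le> s \<and> (\<forall>t\<in>{0<..<s'}. \<forall>t'\<in>{0<..<s'}. \<bar>f t x - f t' x\<bar> < \<epsilon>))"

definition uniformly_convergent_family ::
  "(nat \<Rightarrow> 'a::dense_ordered_group) set \<Rightarrow> 'a \<Rightarrow> ('a \<Rightarrow> (nat \<Rightarrow> 'a) \<Rightarrow> 'a) \<Rightarrow> bool" where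
  "uniformly_convergent_family C s f \<longleftrightarrow>
    (\<forall>\<epsilon>>0. \<exists>s'>0. s' \<le> s \<and>
      (\<forall>x\<in>C. \<forall>t\<in>{0<..<s'}. \<forall>t'\<in>{0<..<s'}. \<bar>f t x - f t' x\<bar> < \<epsilon>))"

end

theory Submission
  imports Defs "HOL-Library.Nat_Bijection"
begin

text \<open>
  If uniform convergence fails for \<open>\<epsilon>\<close>, the sets of all \<open>x \<in> C\<close> with \<open>f t' x + \<epsilon> \<le> f t x\<close> for some
  \<open>t, t' < \<tau>\<close> form a definable family of nonempty bounded sets that shrinks with \<open>\<tau>\<close>. Definable
  completeness gives such a family a cluster point: its last coordinate is the supremum over \<open>\<tau>\<close>
  of the infima of the last coordinate on the sets, and the remaining coordinates are found by
  induction after intersecting the set at \<open>\<tau>\<close> with the strip of width \<open>\<tau>\<close> around that supremum. As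
  \<open>C\<close> is closed, the cluster point lies in \<open>C\<close>, and equicontinuity and pointwise convergence there
  contradict the choice of the sets.
\<close>

section \<open>Definable predicates on environments\<close>

primrec rename_trm :: "(nat \<Rightarrow> nat) \<Rightarrow> 'f trm \<Rightarrow> 'f trm" where
  "rename_trm r (Var i) = Var (r i)"
| "rename_trm r Zero = Zero"
| "rename_trm r (Plus t u) = Plus (rename_trm r t) (rename_trm r u)"
| "rename_trm r (Fun f ts) = Fun f (map (rename_trm r) ts)"

primrec rename_fm :: "(nat \<Rightarrow> nat) \<Rightarrow> ('f, 'r) fm \<Rightarrow> ('f, 'r) fm" where
  "rename_fm r (Equal t u) = Equal (rename_trm r t) (rename_trm r u)"
| "rename_fm r (Less t u) = Less (rename_trm r t) (rename_trm r u)"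
| "rename_fm r (Rel R ts) = Rel R (map (rename_trm r) ts)"
| "rename_fm r (Neg \<phi>) = Neg (rename_fm r \<phi>)"
| "rename_fm r (Conj \<phi> \<psi>) = Conj (rename_fm r \<phi>) (rename_fm r \<psi>)"
| "rename_fm r (Exi i \<phi>) = Exi (r i) (rename_fm r \<phi>)"

lemma trm_val_rename: "trm_val \<M> e (rename_trm r t) = trm_val \<M> (\<lambda>i. e (r i)) t"
  by (induction t) (simp_all add: comp_def cong: map_cong)

text \<open>Injectivity matters at quantifiers: updating \<open>r i\<close> must leave the value at
  every other \<open>r j\<close> unchanged.\<close>

lemma sat_rename:
  assumes "inj r"
  shows "sat \<M> e (rename_fm r \<phi>) \<longleftrightarrow> sat \<M> (\<lambda>i. e (r i)) \<phi>"
proof (induction \<phi> arbitrary: e)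
  case (Exi i \<phi>)
  have "(\<lambda>j. (e(r i := a)) (r j)) = (\<lambda>j. e (r j))(i := a)" for a
    using assms by (auto simp: inj_eq)
  with Exi show ?case by simp
qed (simp_all add: trm_val_rename comp_def)

text \<open>
  Decoding variables into \<open>nat + nat\<close> separates the infinitely many arguments, taken from \<open>e\<close>, from
  infinitely many parameters, taken from \<open>p\<close>. Hence no freshness conditions arise below.
\<close>

definition definable_pred ::
  "('a::dense_ordered_group, 'f, 'r) expansion \<Rightarrow> ((nat \<Rightarrow> 'a) \<Rightarrow> bool) \<Rightarrow> bool" where
  "definable_pred \<M> P \<longleftrightarrow>
    (\<exists>\<phi> p. \<forall>e. P e \<longleftrightarrow> sat \<M> (\<lambda>i. case_sum e p (sum_decode i)) \<phi>)"

text \<open>Any injective placement \<open>r\<close> of the variables among arguments and parameters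
  will do, since composing it with \<open>sum_encode\<close> gives a renaming into the fixed
  coding.\<close>

lemma definable_predI:
  fixes r :: "nat \<Rightarrow> nat + nat"
  assumes "inj r" and "\<And>e. P e \<longleftrightarrow> sat \<M> (\<lambda>i. case_sum e p (r i)) \<phi>"
  shows "definable_pred \<M> P"
proof -
  have "inj (\<lambda>i. sum_encode (r i))"
    using inj_compose[OF inj_sum_encode assms(1)] by (simp add: comp_def)
  then have "P e \<longleftrightarrow> sat \<M> (\<lambda>i. case_sum e p (sum_decode i))
      (rename_fm (\<lambda>i. sum_encode (r i)) \<phi>)" for e
    using assms(2) by (simp add: sat_rename)
  then show ?thesis
    unfolding definable_pred_def by blast
qed

section \<open>Closure under connectives and quantifiers\<close>

lemma definable_pred_not:
  assumes "definable_pred \<M> P"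
  shows "definable_pred \<M> (\<lambda>e. \<not> P e)"
proof -
  obtain \<phi> p where "\<And>e. P e \<longleftrightarrow> sat \<M> (\<lambda>i. case_sum e p (sum_decode i)) \<phi>"
    using assms unfolding definable_pred_def by blast
  then have "\<not> P e \<longleftrightarrow> sat \<M> (\<lambda>i. case_sum e p (sum_decode i)) (Neg \<phi>)" for e
    by simp
  then show ?thesis
    unfolding definable_pred_def by blast
qed

lemma definable_pred_conj:
  assumes "definable_pred \<M> P" and "definable_pred \<M> Q"
  shows "definable_pred \<M> (\<lambda>e. P e \<and> Q e)"
proof -
  obtain \<phi> p where P: "\<And>e. P e \<longleftrightarrow> sat \<M> (\<lambda>i. case_sum e p (sum_decode i)) \<phi>"
    using assms(1) unfolding definable_pred_def by blast
  obtain \<psi> q where Q: "\<And>e. Q e \<longleftrightarrow> sat \<M> (\<lambda>i. case_sum e q (sum_decode i)) \<psi>"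
    using assms(2) unfolding definable_pred_def by blast
  \<comment> \<open>\<open>v Inl\<close> and \<open>v Inr\<close> keep the codes of arguments in
    place and move the parameters of the two formulas to disjoint positions, so that
    \<open>pq\<close> can hold both \<open>p\<close> and \<open>q\<close>.\<close>
  define v where "v j i = sum_encode (map_sum id (\<lambda>k. sum_encode (j k)) (sum_decode i))"
    for j :: "nat \<Rightarrow> nat + nat" and i
  define pq where "pq i = case_sum p q (sum_decode i)" for i
  have inj: "inj (v j)" if "inj j" for j
  proof -
    have "inj (\<lambda>k. sum_encode (j k))"
      using inj_compose[OF inj_sum_encode that] by (simp add: comp_def)
    then have "inj (map_sum id (\<lambda>k. sum_encode (j k)))"
      by (intro sum.inj_map) auto
    from inj_compose[OF inj_sum_encode inj_compose[OF this inj_sum_decode]] show ?thesis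
      by (simp add: v_def[abs_def] comp_def)
  qed
  have "(\<lambda>i. case_sum e pq (sum_decode (v Inl i))) = (\<lambda>i. case_sum e p (sum_decode i))"
    "(\<lambda>i. case_sum e pq (sum_decode (v Inr i))) = (\<lambda>i. case_sum e q (sum_decode i))" for e
    by (auto simp: v_def pq_def fun_eq_iff split: sum.split)
  then have "P e \<and> Q e \<longleftrightarrow> sat \<M> (\<lambda>i. case_sum e pq (sum_decode i))
      (Conj (rename_fm (v Inl) \<phi>) (rename_fm (v Inr) \<psi>))" for e
    by (simp add: sat_rename inj P Q)
  then show ?thesis
    unfolding definable_pred_def by blast
qed

lemma definable_pred_ex:
  assumes "definable_pred \<M> P"
  shows "definable_pred \<M> (\<lambda>e. \<exists>a. P (e(i := a)))"
proof -
  obtain \<phi> p where P: "\<And>e. P e \<longleftrightarrow> sat \<M> (\<lambda>i. case_sum e p (sum_decode i)) \<phi>"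
    using assms unfolding definable_pred_def by blast
  have "(\<lambda>j. case_sum (e(i := a)) p (sum_decode j)) =
      (\<lambda>j. case_sum e p (sum_decode j))(sum_encode (Inl i) := a)" for e a
    by (auto simp: fun_eq_iff split: sum.split) (metis sum_decode_inverse)+
  then have "(\<exists>a. P (e(i := a))) \<longleftrightarrow>
      sat \<M> (\<lambda>j. case_sum e p (sum_decode j)) (Exi (sum_encode (Inl i)) \<phi>)" for e
    by (simp add: P)
  then show ?thesis
    unfolding definable_pred_def by blast
qed

text \<open>Induction on \<open>k\<close>: a block quantifier over the coordinates below
  \<open>Suc k\<close> is a single quantifier over coordinate \<open>k\<close> in front of the block
  below \<open>k\<close>.\<close>

lemma definable_pred_ex_below:
  assumes "definable_pred \<M> P"
  shows "definable_pred \<M> (\<lambda>e. \<exists>x. P (\<lambda>i. if i < k then x i else e i))"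
proof (induction k)
  case 0
  from assms show ?case by simp
next
  case (Suc k)
  have "(\<exists>x. P (\<lambda>i. if i < Suc k then x i else e i)) \<longleftrightarrow>
      (\<exists>a x. P (\<lambda>i. if i < k then x i else (e(k := a)) i))" (is "?L \<longleftrightarrow> ?R") for e
  proof
    assume ?L
    then obtain x where "P (\<lambda>i. if i < Suc k then x i else e i)" ..
    moreover have "(\<lambda>i. if i < Suc k then x i else e i) =
        (\<lambda>i. if i < k then x i else (e(k := x k)) i)"
      by (auto simp: fun_eq_iff less_Suc_eq)
    ultimately have "P (\<lambda>i. if i < k then x i else (e(k := x k)) i)" by (simp only:)
    then show ?R by (intro exI)
  next
    assume ?R
    then obtain a x where "P (\<lambda>i. if i < k then x i else (e(k := a)) i)" by blast
    moreover have "(\<lambda>i. if i < Suc k then (x(k := a)) i else e i) =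
        (\<lambda>i. if i < k then x i else (e(k := a)) i)"
      by (auto simp: fun_eq_iff less_Suc_eq)
    ultimately have "P (\<lambda>i. if i < Suc k then (x(k := a)) i else e i)" by (simp only:)
    then show ?L by (intro exI)
  qed
  with definable_pred_ex[OF Suc, of k] show ?case by simp
qed

section \<open>Atomic predicates, constants and substitutions\<close>

lemma definable_pred_sat: "definable_pred \<M> (\<lambda>e. sat \<M> e \<phi>)"
  by (rule definable_predI[of Inl _ _ _ \<phi>]) auto

lemma definable_pred_less: "definable_pred \<M> (\<lambda>e. e i < e j)"
  using definable_pred_sat[of \<M> "Less (Var i) (Var j)"] by simp

lemma definable_pred_less_add: "definable_pred \<M> (\<lambda>e. e i < e j + e k)"
  using definable_pred_sat[of \<M> "Less (Var i) (Plus (Var j) (Var k))"] by simp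

text \<open>\<open>Var 0\<close> is placed at argument \<open>i\<close>; every other variable, in
  particular \<open>Var 1\<close>, becomes a parameter with value \<open>c\<close>.\<close>

lemma definable_pred_eq_const: "definable_pred \<M> (\<lambda>e. e i = c)"
  by (rule definable_predI[of "\<lambda>j. if j = 0 then Inl i else Inr j" _ _ "\<lambda>_. c"
        "Equal (Var 0) (Var 1)"]) (auto simp: inj_def)

lemma definable_pred_const:
  assumes "definable_pred \<M> P"
  shows "definable_pred \<M> (\<lambda>e. P (e(i := c)))"
  using definable_pred_ex[OF definable_pred_conj[OF definable_pred_eq_const[of \<M> i c] assms], where i = i]
  by simp

text \<open>The substitution amounts to asking for a value at \<open>i\<close> that equals
  \<open>e j\<close>. For \<open>i = j\<close> this would compare the new value with itself, hence
  the case distinction.\<close>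

lemma definable_pred_subst:
  assumes "definable_pred \<M> P"
  shows "definable_pred \<M> (\<lambda>e. P (e(i := e j)))"
proof (cases "i = j")
  case False
  have eq: "definable_pred \<M> (\<lambda>e. e i = e j)"
    using definable_pred_sat[of \<M> "Equal (Var i) (Var j)"] by simp
  show ?thesis
    using definable_pred_ex[OF definable_pred_conj[OF eq assms], where i = i] False by simp
qed (use assms in simp)

section \<open>Passage between definable sets and definable predicates\<close>

lemma definable_pred_of_sat:
  "definable_pred \<M> (\<lambda>e. sat \<M> (\<lambda>i. if i < n then e i else p i) \<phi>)"
proof (rule definable_predI[of "\<lambda>i. if i < n then Inl i else Inr i" _ _ p])
  show "inj (\<lambda>i. if i < n then Inl i else Inr i)"
    by (auto simp: inj_def split: if_splits)
  have "(\<lambda>i. case_sum e p (if i < n then Inl i else Inr i)) = (\<lambda>i. if i < n then e i else p i)"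
    for e by auto
  then show "sat \<M> (\<lambda>i. if i < n then e i else p i) \<phi> \<longleftrightarrow>
      sat \<M> (\<lambda>i. case_sum e p (if i < n then Inl i else Inr i)) \<phi>" for e
    by simp
qed

lemma definable_slice:
  assumes "definable_pred \<M> P"
  shows "definable \<M> 1 {x \<in> cart_power 1. x 0 \<in> {a. P (e(j := a))}}"
proof -
  obtain \<phi> p where P: "\<And>e. P e \<longleftrightarrow> sat \<M> (\<lambda>i. case_sum e p (sum_decode i)) \<phi>"
    using assms unfolding definable_pred_def by blast
  \<comment> \<open>The variable coding argument \<open>j\<close> becomes coordinate
    \<open>0\<close>; all others are shifted up by one to become parameters, and \<open>q\<close>
    undoes the shift.\<close>
  define r where "r i = (if i = sum_encode (Inl j) then 0 else Suc i)" for i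
  define q where "q i = case_sum e p (sum_decode (i - 1))" for i
  have "inj r"
    by (auto simp: r_def inj_def split: if_splits)
  have "(\<lambda>i. if r i < 1 then x (r i) else q (r i)) =
      (\<lambda>i. case_sum (e(j := x 0)) p (sum_decode i))" for x :: "nat \<Rightarrow> 'a"
    by (auto simp: r_def q_def fun_eq_iff split: sum.split) (metis sum_decode_inverse)
  then have "P (e(j := x 0)) \<longleftrightarrow>
      sat \<M> (\<lambda>i. if i < 1 then x i else q i) (rename_fm r \<phi>)" for x
    by (simp only: P sat_rename[OF \<open>inj r\<close>])
  then show ?thesis
    unfolding definable_def by auto
qed

lemma abs_less_iff_group:
  fixes a b :: "'a::dense_ordered_group"
  shows "\<bar>a\<bar> < b \<longleftrightarrow> a < b \<and> - a < b"
proof (cases "0 \<le> a")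
  case True
  then have "- a \<le> a" by simp
  with True show ?thesis by (simp, blast intro: le_less_trans)
next
  case False
  then have "a \<le> - a" by simp
  with False show ?thesis by (simp, blast intro: le_less_trans)
qed

section \<open>Cluster points of definable families\<close>

lemma definably_complete_sup:
  assumes "definably_complete \<M>" and "definable_pred \<M> P"
    and "a0 \<in> A" and "\<And>a. a \<in> A \<Longrightarrow> a \<le> b" and A: "A = {a. P (e(j := a))}"
  obtains u where "\<And>a. a \<in> A \<Longrightarrow> a \<le> u" and "\<And>v. v < u \<Longrightarrow> \<exists>a\<in>A. v < a"
proof -
  obtain w where w: "isLub UNIV (Fin ` A) w"
    using assms(1) definable_slice[OF assms(2), of e j]
    unfolding definably_complete_def A by blast
  have ub: "Fin a \<le> w" if "a \<in> A" for a
    using isLubD2[OF w] that by blast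
  have least: "w \<le> Fin v" if "\<And>a. a \<in> A \<Longrightarrow> a \<le> v" for v
    using isLub_le_isUb[OF w, of "Fin v"] that by (auto simp: isUb_def setle_def)
  \<comment> \<open>The element \<open>a0\<close> excludes the value minus infinity for
    \<open>w\<close>, and the bound \<open>b\<close> excludes plus infinity.\<close>
  obtain u where u: "w = Fin u"
    using ub[OF \<open>a0 \<in> A\<close>] least[of b] assms(4) by (cases w) auto
  show thesis
  proof
    show "a \<le> u" if "a \<in> A" for a
      using ub[OF that] u by simp
    show "\<exists>a\<in>A. v < a" if "v < u" for v
      using least[of v] u that by force
  qed
qed

text \<open>
  The set of the family at \<open>\<tau>\<close> consists of the \<open>x\<close> with \<open>P (x(k := \<tau>))\<close>; only its coordinates below
  \<open>k\<close> matter, and cluster points are sought for the first \<open>n\<close> of them.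
\<close>

lemma definable_family_cluster_point:
  fixes \<M> :: "('a::dense_ordered_group, 'f, 'r) expansion"
  assumes complete: "definably_complete \<M>" and "n \<le> k"
    and "definable_pred \<M> P"
    and "\<And>e e'. (\<And>i. i \<le> k \<Longrightarrow> e i = e' i) \<Longrightarrow> P e \<Longrightarrow> P e'"
    and "\<And>\<tau> \<tau>' x. 0 < \<tau> \<Longrightarrow> \<tau> \<le> \<tau>' \<Longrightarrow> P (x(k := \<tau>)) \<Longrightarrow> P (x(k := \<tau>'))"
    and "\<And>\<tau> x i. 0 < \<tau> \<Longrightarrow> P (x(k := \<tau>)) \<Longrightarrow> i < n \<Longrightarrow> \<bar>x i\<bar> \<le> r"
    and "\<And>\<tau>. 0 < \<tau> \<Longrightarrow> \<exists>x. P (x(k := \<tau>))"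
    and "\<exists>\<tau>::'a. 0 < \<tau>"
  shows "\<exists>c. \<forall>\<tau>>0. \<forall>\<delta>>0. \<exists>x. P (x(k := \<tau>)) \<and> (\<forall>i<n. \<bar>x i - c i\<bar> < \<delta>)"
  using assms(2-)
proof (induction n arbitrary: P)
  case 0
  show ?case using "0.prems"(6) by blast
next
  case (Suc n)
  note dep = Suc.prems(3) and mono = Suc.prems(4) and bdd = Suc.prems(5) and ne = Suc.prems(6)
  have "n < k" using Suc.prems(1) by simp
  \<comment> \<open>\<open>A\<close> collects the lower bounds of coordinate \<open>n\<close> that
    hold on some set of the family. Its supremum is that of the infima, without forming the infima
    themselves.\<close>
  define A where "A = {a. \<exists>\<tau>>0. \<forall>x. P (x(k := \<tau>)) \<longrightarrow> a \<le> x n}"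
  \<comment> \<open>\<open>Q\<close> defines \<open>A\<close> by a formula: variable
    \<open>Suc k\<close>, on which \<open>P\<close> does not depend, carries \<open>a\<close>, and
    variable \<open>k\<close> carries \<open>\<tau>\<close>.\<close>
  define Q where "Q e \<longleftrightarrow> (\<exists>\<tau>. 0 < \<tau> \<and>
    \<not> (\<exists>x. P (\<lambda>i. if i < k then x i else (e(k := \<tau>)) i) \<and> x n < e (Suc k)))" for e
  have "definable_pred \<M> (\<lambda>e. P e \<and> e n < e (Suc k))"
    by (intro definable_pred_conj Suc.prems definable_pred_less)
  from definable_pred_not[OF definable_pred_ex_below[OF this, of k]]
  have inner: "definable_pred \<M>
      (\<lambda>e. \<not> (\<exists>x. P (\<lambda>i. if i < k then x i else e i) \<and> x n < e (Suc k)))"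
    using \<open>n < k\<close> by simp
  have "definable_pred \<M> (\<lambda>e. 0 < e k)"
    using definable_pred_sat[of \<M> "Less Zero (Var k)"] by simp
  from definable_pred_ex[OF definable_pred_conj[OF this inner], of k]
  have Q: "definable_pred \<M> Q"
    by (simp add: Q_def[abs_def])
  have upd: "P (\<lambda>i. if i < k then x i else (e(k := \<tau>)) i) \<longleftrightarrow> P (x(k := \<tau>))" for x e \<tau>
    by (rule iffI; erule dep[rotated]; auto)
  have A: "A = {a. Q ((\<lambda>_. 0)(Suc k := a))}"
    unfolding A_def Q_def
    using upd[of _ "(\<lambda>_. 0)(Suc k := _)"] by (auto simp: not_less fun_upd_twist)
  obtain \<tau>0 :: 'a where "0 < \<tau>0" using Suc.prems(7) by blast
  have "- r \<le> x n" if "P (x(k := \<tau>0))" for x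
    using bdd[OF \<open>0 < \<tau>0\<close> that, of n] by (simp add: abs_le_iff minus_le_iff)
  then have "- r \<in> A"
    using \<open>0 < \<tau>0\<close> unfolding A_def by blast
  moreover have "a \<le> r" if "a \<in> A" for a
  proof -
    obtain \<tau> where "0 < \<tau>" and \<tau>: "\<And>x. P (x(k := \<tau>)) \<Longrightarrow> a \<le> x n"
      using \<open>a \<in> A\<close> unfolding A_def by blast
    obtain x where x: "P (x(k := \<tau>))"
      using ne[OF \<open>0 < \<tau>\<close>] ..
    show ?thesis
      using \<tau>[OF x] bdd[OF \<open>0 < \<tau>\<close> x, of n] by (auto simp: abs_le_iff)
  qed
  ultimately obtain u where u: "\<And>a. a \<in> A \<Longrightarrow> a \<le> u" "\<And>v. v < u \<Longrightarrow> \<exists>a\<in>A. v < a"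
    using definably_complete_sup[OF complete Q _ _ A] by blast
  \<comment> \<open>Some \<open>a \<in> A\<close> above \<open>u - \<delta>\<close> bounds
    coordinate \<open>n\<close> from below on the set at \<open>\<tau>1\<close>, while
    \<open>u + \<delta> \<notin> A\<close> yields a point of the set at
    \<open>min \<tau> \<tau>1\<close> where it is less than \<open>u + \<delta>\<close>.\<close>
  have near: "\<exists>x. P (x(k := \<tau>)) \<and> \<bar>x n - u\<bar> < \<delta>" if "0 < \<tau>" "0 < \<delta>" for \<tau> \<delta>
  proof -
    have "u - \<delta> < u" using \<open>0 < \<delta>\<close> by simp
    then obtain a where "a \<in> A" and a: "u - \<delta> < a"
      using u(2) by blast
    then obtain \<tau>1 where "0 < \<tau>1" and \<tau>1: "\<And>x. P (x(k := \<tau>1)) \<Longrightarrow> a \<le> x n"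
      unfolding A_def by blast
    have "\<not> u + \<delta> \<le> u" using \<open>0 < \<delta>\<close> by simp
    then have "u + \<delta> \<notin> A" using u(1) by blast
    moreover have pos: "0 < min \<tau> \<tau>1" using \<open>0 < \<tau>\<close> \<open>0 < \<tau>1\<close> by simp
    ultimately obtain x where x: "P (x(k := min \<tau> \<tau>1))" and lt: "x n < u + \<delta>"
      unfolding A_def mem_Collect_eq by (metis not_le)
    have "P (x(k := \<tau>))" by (rule mono[OF pos _ x]) simp
    moreover have "a \<le> x n" by (intro \<tau>1 mono[OF pos _ x]) simp
    with a have "u - \<delta> < x n" by (rule less_le_trans)
    then have "\<bar>x n - u\<bar> < \<delta>"
      using lt by (auto simp: abs_less_iff_group algebra_simps)
    ultimately show ?thesis by blast
  qed
  \<comment> \<open>The width of the strip is the family parameter itself, so \<open>P'\<close>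
    again shrinks with it and forces coordinate \<open>n\<close> towards \<open>u\<close>.\<close>
  define P' where "P' e \<longleftrightarrow> P e \<and> \<bar>e n - u\<bar> < e k" for e
  have "\<exists>c. \<forall>\<tau>>0. \<forall>\<delta>>0. \<exists>x. P' (x(k := \<tau>)) \<and> (\<forall>i<n. \<bar>x i - c i\<bar> < \<delta>)"
  proof (rule Suc.IH)
    have "definable_pred \<M> (\<lambda>e. e n < u + e k)" "definable_pred \<M> (\<lambda>e. u < e n + e k)"
      using definable_pred_const[OF definable_pred_less_add[of \<M> n "Suc k" k],
            where i = "Suc k" and c = u]
        definable_pred_const[OF definable_pred_less_add[of \<M> "Suc k" n k],
            where i = "Suc k" and c = u] \<open>n < k\<close>
      by simp_all
    then have "definable_pred \<M> (\<lambda>e. P e \<and> e n < u + e k \<and> u < e n + e k)"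
      by (intro definable_pred_conj Suc.prems)
    moreover have "P' = (\<lambda>e. P e \<and> e n < u + e k \<and> u < e n + e k)"
      by (auto simp: P'_def fun_eq_iff abs_less_iff_group algebra_simps)
    ultimately show "definable_pred \<M> P'" by simp
    show "P' e'" if "\<And>i. i \<le> k \<Longrightarrow> e i = e' i" "P' e" for e e'
      using that dep[of e e'] \<open>n < k\<close> by (auto simp: P'_def)
    show "P' (x(k := \<tau>'))" if "0 < \<tau>" "\<tau> \<le> \<tau>'" "P' (x(k := \<tau>))" for \<tau> \<tau>' x
    proof -
      have x: "P (x(k := \<tau>))" "\<bar>x n - u\<bar> < \<tau>"
        using that(3) \<open>n < k\<close> by (simp_all add: P'_def)
      have "P (x(k := \<tau>'))"
        by (rule mono[OF that(1,2) x(1)])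
      moreover have "\<bar>x n - u\<bar> < \<tau>'"
        using x(2) that(2) by (rule less_le_trans)
      ultimately show ?thesis
        using \<open>n < k\<close> by (simp add: P'_def)
    qed
    show "\<bar>x i\<bar> \<le> r" if "0 < \<tau>" "P' (x(k := \<tau>))" "i < n" for \<tau> x i
    proof -
      have "P (x(k := \<tau>))"
        using that(2) by (simp add: P'_def)
      from bdd[OF that(1) this] that(3) show ?thesis by simp
    qed
    \<comment> \<open>Nonemptiness is \<open>near\<close> with distance
      \<open>\<tau>\<close>.\<close>
    show "\<exists>x. P' (x(k := \<tau>))" if "0 < \<tau>" for \<tau>
      using near[OF that that] \<open>n < k\<close> by (simp add: P'_def)
  qed (use \<open>n < k\<close> Suc.prems(7) in auto)
  then obtain c where c: "\<And>\<tau> \<delta>. 0 < \<tau> \<Longrightarrow> 0 < \<delta> \<Longrightarrow>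
      \<exists>x. P' (x(k := \<tau>)) \<and> (\<forall>i<n. \<bar>x i - c i\<bar> < \<delta>)" by blast
  have "\<exists>x. P (x(k := \<tau>)) \<and> (\<forall>i<Suc n. \<bar>x i - (c(n := u)) i\<bar> < \<delta>)"
    if "0 < \<tau>" "0 < \<delta>" for \<tau> \<delta>
  proof -
    \<comment> \<open>At parameter \<open>min \<tau> \<delta>\<close> the strip is narrow enough for
      \<open>\<delta>\<close>, and monotonicity leads back to \<open>\<tau>\<close>.\<close>
    have pos: "0 < min \<tau> \<delta>" using that by simp
    obtain x where x: "P' (x(k := min \<tau> \<delta>))" "\<And>i. i < n \<Longrightarrow> \<bar>x i - c i\<bar> < \<delta>"
      using c[OF pos \<open>0 < \<delta>\<close>] by blast
    have "P (x(k := min \<tau> \<delta>))"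
      using x(1) by (simp add: P'_def)
    then have "P (x(k := \<tau>))"
      by (rule mono[OF pos, rotated]) simp
    moreover have "\<bar>x n - u\<bar> < \<delta>"
      using x(1) \<open>n < k\<close> by (auto simp: P'_def)
    ultimately show ?thesis
      using x(2) by (auto simp: less_Suc_eq)
  qed
  then show ?case by blast
qed

section \<open>Closed sets and the convergence theorem\<close>

text \<open>The points \<open>c - d\<close> and \<open>c + d\<close> show that \<open>c\<close> is
  no end point of the order, so \<open>U\<close> contains an interval on either side of
  \<open>c\<close>; the smaller length serves as radius.\<close>

lemma open_contains_abs_interval:
  fixes U :: "'a::dense_ordered_group set"
  assumes "open U" "c \<in> U" "(0::'a) < d"
  shows "\<exists>\<delta>>0. \<forall>x. \<bar>x - c\<bar> < \<delta> \<longrightarrow> x \<in> U"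
proof -
  obtain b where b: "c < b" "{c..<b} \<subseteq> U"
    using open_right[OF assms(1,2), of "c + d"] assms(3) by auto
  obtain a where a: "a < c" "{a<..c} \<subseteq> U"
    using open_left[OF assms(1,2), of "c - d"] assms(3) by auto
  show ?thesis
  proof (intro exI conjI allI impI)
    show "0 < min (b - c) (c - a)" using a b by simp
    fix x assume "\<bar>x - c\<bar> < min (b - c) (c - a)"
    then have "a < x" "x < b"
      by (auto simp: abs_less_iff_group)
    then show "x \<in> U"
      using a(2) b(2) by (cases "c \<le> x") auto
  qed
qed

text \<open>Otherwise a basic open box around \<open>c\<close> misses \<open>C\<close>; it has
  finitely many factors, so one radius serves for all of them.\<close>

lemma closed_set_cluster_point:
  fixes C :: "(nat \<Rightarrow> 'a::dense_ordered_group) set"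
  assumes "closed_set m C" "c \<in> cart_power m" "(0::'a) < d"
    and near: "\<And>\<delta>. 0 < \<delta> \<Longrightarrow> \<exists>x\<in>C. \<forall>i<m. \<bar>x i - c i\<bar> < \<delta>"
  shows "c \<in> C"
proof (rule ccontr)
  assume "c \<notin> C"
  have C: "C \<subseteq> cart_power m" "openin (product_topology (\<lambda>_. euclidean) {..<m}) (cart_power m - C)"
    using assms(1) by (auto simp: closed_set_def closedin_def)
  then obtain U where U: "\<And>i. open (U i)" "c \<in> (\<Pi>\<^sub>E i\<in>{..<m}. U i)"
      "(\<Pi>\<^sub>E i\<in>{..<m}. U i) \<subseteq> cart_power m - C"
    using product_topology_open_contains_basis[OF C(2), of c] assms(2) \<open>c \<notin> C\<close> by auto
  have "\<exists>\<delta>>0. \<forall>x. \<bar>x - c i\<bar> < \<delta> \<longrightarrow> x \<in> U i" if "i < m" for i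
    using open_contains_abs_interval[OF U(1) _ assms(3)] U(2) that by auto
  then obtain \<delta> where \<delta>: "\<And>i. i < m \<Longrightarrow> 0 < \<delta> i"
      "\<And>i x. i < m \<Longrightarrow> \<bar>x - c i\<bar> < \<delta> i \<Longrightarrow> x \<in> U i"
    by metis
  \<comment> \<open>Including \<open>d\<close> keeps the set nonempty when
    \<open>m = 0\<close>.\<close>
  have "0 < Min (insert d (\<delta> ` {..<m}))"
    using \<delta>(1) assms(3) by simp
  then obtain x where x: "x \<in> C" "\<And>i. i < m \<Longrightarrow> \<bar>x i - c i\<bar> < Min (insert d (\<delta> ` {..<m}))"
    using near by blast
  have "x i \<in> U i" if "i < m" for i
    using x(2)[OF that] \<delta>(2)[OF that] that by simp
  then have "x \<in> (\<Pi>\<^sub>E i\<in>{..<m}. U i)"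
    using C(1) x(1) by (auto simp: PiE_iff)
  then show False
    using U(3) x(1) by blast
qed

text \<open>Density replaces division: for \<open>b\<close> strictly between \<open>0\<close> and
  \<open>\<zeta>\<close>, twice \<open>min b (\<zeta> - b)\<close> is at most
  \<open>\<zeta>\<close>. Halving twice leaves room for three summands.\<close>

lemma exists_third:
  fixes \<epsilon> :: "'a::dense_ordered_group"
  assumes "0 < \<epsilon>"
  obtains \<eta> where "0 < \<eta>" "\<eta> + \<eta> + \<eta> \<le> \<epsilon>"
proof -
  have half: "\<exists>\<eta>>0. \<eta> + \<eta> \<le> \<zeta>" if "0 < \<zeta>" for \<zeta> :: 'a
  proof -
    obtain b where "0 < b" "b < \<zeta>" using dense[OF \<open>0 < \<zeta>\<close>] by blast
    then have "0 < min b (\<zeta> - b)" by simp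
    moreover have "min b (\<zeta> - b) + min b (\<zeta> - b) \<le> b + (\<zeta> - b)"
      by (intro add_mono) auto
    ultimately show ?thesis by (metis add_diff_cancel_left' add_diff_eq)
  qed
  obtain \<zeta> where \<zeta>: "0 < \<zeta>" "\<zeta> + \<zeta> \<le> \<epsilon>" using half[OF assms] by blast
  obtain \<eta> where \<eta>: "0 < \<eta>" "\<eta> + \<eta> \<le> \<zeta>" using half[OF \<zeta>(1)] by blast
  have "\<eta> \<le> \<eta> + \<eta>" using \<eta>(1) by simp
  then have "\<eta> \<le> \<zeta>" using \<eta>(2) by (rule order_trans)
  then have "\<eta> + \<eta> + \<eta> \<le> \<zeta> + \<zeta>" using \<eta>(2) by (intro add_mono)
  with \<zeta>(2) \<eta>(1) that show thesis by (meson order_trans)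
qed

lemma max_norm_less_iff:
  "0 < \<delta> \<Longrightarrow> max_norm n x < \<delta> \<longleftrightarrow> (\<forall>i<n. \<bar>x i\<bar> < \<delta>)"
  by (auto simp: max_norm_def)

lemma abs_le_max_norm: "i < n \<Longrightarrow> \<bar>x i\<bar> \<le> max_norm n x"
  by (auto simp: max_norm_def)

section \<open>Definability of the oscillation sets\<close>

lemma definable_family_graph:
  assumes "definable_family \<M> m C s f" and "C \<subseteq> cart_power m"
  shows "definable_pred \<M> (\<lambda>e. restrict e {..<m} \<in> C \<and> e m \<in> {0<..<s} \<and>
    e (Suc m) = f (e m) (restrict e {..<m}))"
proof -
  let ?G = "{x(m := t, m + 1 := f t x) |x t. x \<in> C \<and> t \<in> {0<..<s}}"
  obtain \<phi> p where G: "?G = {x \<in> cart_power (m + 2). sat \<M> (\<lambda>i. if i < m + 2 then x i else p i) \<phi>}"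
    using assms(1) unfolding definable_family_def definable_def by blast
  have "sat \<M> (\<lambda>i. if i < m + 2 then e i else p i) \<phi> \<longleftrightarrow> restrict e {..<m} \<in> C \<and>
      e m \<in> {0<..<s} \<and> e (Suc m) = f (e m) (restrict e {..<m})" (is "?L e \<longleftrightarrow> ?R") for e
  proof -
    \<comment> \<open>The formula reads \<open>e\<close> only below \<open>m + 2\<close>, so
      \<open>e\<close> may be cut down to an extensional point.\<close>
    have "(\<lambda>i. if i < m + 2 then restrict e {..<m + 2} i else p i) =
        (\<lambda>i. if i < m + 2 then e i else p i)"
      by auto
    then have "?L e \<longleftrightarrow> restrict e {..<m + 2} \<in> ?G"
      unfolding G by (simp del: add_2_eq_Suc')
    also have "\<dots> \<longleftrightarrow> ?R"
    proof
      assume "restrict e {..<m + 2} \<in> ?G"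
      then obtain x t where x: "x \<in> C" "t \<in> {0<..<s}"
        and e: "restrict e {..<m + 2} = x(m := t, m + 1 := f t x)" by blast
      \<comment> \<open>From index \<open>m\<close> on both sides are \<open>undefined\<close>,
        because points of \<open>C\<close> are extensional; this recovers \<open>x\<close> from the
        updated point.\<close>
      have "x i = restrict e {..<m} i" for i
        using fun_cong[OF e, of i] x(1) assms(2) by (auto simp: PiE_iff extensional_def)
      then have "x = restrict e {..<m}" ..
      moreover have "e m = t" "e (Suc m) = f t x"
        using fun_cong[OF e, of m] fun_cong[OF e, of "Suc m"] by auto
      ultimately show ?R using x by simp
    next
      assume R: ?R
      have "restrict e {..<m + 2} =
          (restrict e {..<m})(m := e m, m + 1 := f (e m) (restrict e {..<m}))"
        using R by (auto simp: fun_eq_iff less_Suc_eq)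
      with R show "restrict e {..<m + 2} \<in> ?G" by blast
    qed
    finally show ?thesis .
  qed
  with definable_pred_of_sat[of \<M> "m + 2" p \<phi>] show ?thesis by simp
qed

lemma definable_pred_oscillation:
  fixes f :: "'a::dense_ordered_group \<Rightarrow> (nat \<Rightarrow> 'a) \<Rightarrow> 'a"
  assumes "definable_family \<M> m C s f" and "C \<subseteq> cart_power m"
  shows "definable_pred \<M> (\<lambda>e. restrict e {..<m} \<in> C \<and> (\<exists>t\<in>{0<..<s}. \<exists>t'\<in>{0<..<s}.
    t < e m \<and> t' < e m \<and> f t' (restrict e {..<m}) + \<epsilon> \<le> f t (restrict e {..<m})))"
proof -
  define g where "g e \<longleftrightarrow> restrict e {..<m} \<in> C \<and> e m \<in> {0<..<s} \<and>
    e (Suc m) = f (e m) (restrict e {..<m})" for e :: "nat \<Rightarrow> 'a"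
  \<comment> \<open>Variables \<open>m+2\<close> to \<open>m+5\<close> hold \<open>t\<close>,
    \<open>f t x\<close>, \<open>t'\<close> and \<open>f t' x\<close>. Each pair is copied into
    \<open>m\<close> and \<open>m+1\<close>, where \<open>g\<close> expects it, while variable
    \<open>m\<close> of \<open>e\<close> itself keeps the bound on \<open>t\<close> and
    \<open>t'\<close>.\<close>
  define h where "h e \<longleftrightarrow> g (e(m := e (m+2), m+1 := e (m+3))) \<and> g (e(m := e (m+4), m+1 := e (m+5))) \<and>
    e (m+2) < e m \<and> e (m+4) < e m \<and> \<not> e (m+3) < e (m+5) + \<epsilon>" for e
  have g: "definable_pred \<M> g"
    unfolding g_def[abs_def] by (rule definable_family_graph[OF assms])
  have "definable_pred \<M> (\<lambda>e. g (e(m := e (m+2), m+1 := e (m+3))))"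
    "definable_pred \<M> (\<lambda>e. g (e(m := e (m+4), m+1 := e (m+5))))"
    using definable_pred_subst[OF definable_pred_subst[OF g, of "m+1" "m+3"], of m "m+2"]
      definable_pred_subst[OF definable_pred_subst[OF g, of "m+1" "m+5"], of m "m+4"]
    by simp_all
  moreover have "definable_pred \<M> (\<lambda>e. e (m+3) < e (m+5) + \<epsilon>)"
    using definable_pred_const[OF definable_pred_less_add[of \<M> "m+3" "m+5" "m+6"],
        where i = "m+6" and c = \<epsilon>]
    by simp
  ultimately have h: "definable_pred \<M> h"
    unfolding h_def[abs_def]
    by (intro definable_pred_conj definable_pred_not definable_pred_less)
  have "definable_pred \<M>
      (\<lambda>e. \<exists>t y t' y'. h (e(m+2 := t, m+3 := y, m+4 := t', m+5 := y')))"
    by (intro definable_pred_ex h)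
  moreover have "(\<exists>t y t' y'. h (e(m+2 := t, m+3 := y, m+4 := t', m+5 := y'))) \<longleftrightarrow>
      restrict e {..<m} \<in> C \<and> (\<exists>t\<in>{0<..<s}. \<exists>t'\<in>{0<..<s}.
        t < e m \<and> t' < e m \<and> f t' (restrict e {..<m}) + \<epsilon> \<le> f t (restrict e {..<m}))" (is "?L \<longleftrightarrow> ?R") for e
  proof -
    have "restrict (e(m+2 := t, m+3 := y, m+4 := t', m+5 := y', m := v, Suc m := w)) {..<m} =
        restrict e {..<m}" for t y t' y' v w
      by (auto simp: restrict_def fun_eq_iff)
    then have H: "h (e(m+2 := t, m+3 := y, m+4 := t', m+5 := y')) \<longleftrightarrow> restrict e {..<m} \<in> C \<and>
        t \<in> {0<..<s} \<and> t' \<in> {0<..<s} \<and> t < e m \<and> t' < e m \<and> y' + \<epsilon> \<le> y \<and>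
        y = f t (restrict e {..<m}) \<and> y' = f t' (restrict e {..<m})" for t y t' y'
      by (auto simp: h_def g_def not_less)
    show ?thesis
    proof
      assume ?L
      then obtain t y t' y' where "h (e(m+2 := t, m+3 := y, m+4 := t', m+5 := y'))"
        by (elim exE)
      then show ?R
        unfolding H by blast
    next
      assume ?R
      then obtain t t' where "restrict e {..<m} \<in> C" "t \<in> {0<..<s}" "t' \<in> {0<..<s}"
        "t < e m" "t' < e m" "f t' (restrict e {..<m}) + \<epsilon> \<le> f t (restrict e {..<m})"
        by blast
      then have "h (e(m+2 := t, m+3 := f t (restrict e {..<m}),
          m+4 := t', m+5 := f t' (restrict e {..<m})))"
        unfolding H by simp
      then show ?L
        by (intro exI)
    qed
  qed
  ultimately show ?thesis by simp
qed

theorem theorem4p10: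
  fixes \<M> :: "('a::dense_ordered_group, 'f, 'r) expansion"
    and m :: nat
    and C :: "(nat \<Rightarrow> 'a) set"
    and s :: 'a
    and f :: "'a \<Rightarrow> (nat \<Rightarrow> 'a) \<Rightarrow> 'a"
  assumes "DCULOAS \<M>"
    and "C \<subseteq> cart_power m"
    and "definable \<M> m C"
    and "closed_set m C"
    and "bounded_set m C"
    and "s > 0"
    and "definable_family \<M> m C s f"
    and "equicontinuous_family m C s f"
    and "pointwise_convergent_family C s f"
  shows "uniformly_convergent_family C s f"
proof (rule ccontr)
  assume "\<not> uniformly_convergent_family C s f"
  then obtain \<epsilon> where "0 < \<epsilon>" and \<epsilon>: "\<And>\<tau>. 0 < \<tau> \<Longrightarrow> \<tau> \<le> s \<Longrightarrow>
      \<exists>x\<in>C. \<exists>t\<in>{0<..<\<tau>}. \<exists>t'\<in>{0<..<\<tau>}. \<not> \<bar>f t x - f t' x\<bar> < \<epsilon>"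
    unfolding uniformly_convergent_family_def by blast
  \<comment> \<open>The one-sided inequality suffices because \<open>t\<close> and \<open>t'\<close>
    can be swapped. The separate bound \<open>s\<close> lets every positive \<open>e m\<close> serve
    as parameter, also beyond \<open>s\<close>.\<close>
  define P where "P e \<longleftrightarrow> restrict e {..<m} \<in> C \<and> (\<exists>t\<in>{0<..<s}. \<exists>t'\<in>{0<..<s}.
    t < e m \<and> t' < e m \<and> f t' (restrict e {..<m}) + \<epsilon> \<le> f t (restrict e {..<m}))" for e
  have upd: "restrict (x(m := \<tau>)) {..<m} = restrict x {..<m}" for x and \<tau> :: 'a
    by (auto simp: restrict_def fun_eq_iff)
  obtain r where r: "\<And>x. x \<in> C \<Longrightarrow> max_norm m x \<le> r"
    using assms(5) unfolding bounded_set_def by blast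
  have "\<exists>c. \<forall>\<tau>>0. \<forall>\<delta>>0. \<exists>x. P (x(m := \<tau>)) \<and> (\<forall>i<m. \<bar>x i - c i\<bar> < \<delta>)"
  proof (rule definable_family_cluster_point)
    show "definably_complete \<M>" using assms(1) by (simp add: DCULOAS_def)
    show "definable_pred \<M> P"
      unfolding P_def[abs_def] by (rule definable_pred_oscillation[OF assms(7,2)])
    show "P e'" if "\<And>i. i \<le> m \<Longrightarrow> e i = e' i" "P e" for e e'
    proof -
      have "restrict e {..<m} = restrict e' {..<m}" "e m = e' m"
        using that(1) by (auto simp: restrict_def fun_eq_iff)
      with that(2) show ?thesis by (simp add: P_def)
    qed
    show "P (x(m := \<tau>'))" if "\<tau> \<le> \<tau>'" "P (x(m := \<tau>))" for \<tau> \<tau>' x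
      using that unfolding P_def upd by (auto intro: less_le_trans)
    show "\<bar>x i\<bar> \<le> r" if "P (x(m := \<tau>))" "i < m" for \<tau> x i
      using that r[of "restrict x {..<m}"] abs_le_max_norm[of i m "restrict x {..<m}"]
      unfolding P_def upd by auto
    show "\<exists>x. P (x(m := \<tau>))" if "0 < \<tau>" for \<tau>
    proof -
      have "0 < min \<tau> s" "min \<tau> s \<le> s" using that assms(6) by auto
      then obtain x t t' where x: "x \<in> C" "t \<in> {0<..<min \<tau> s}" "t' \<in> {0<..<min \<tau> s}"
        and "\<not> \<bar>f t x - f t' x\<bar> < \<epsilon>"
        using \<epsilon> by blast
      then have "f t' x + \<epsilon> \<le> f t x \<or> f t x + \<epsilon> \<le> f t' x"
        unfolding abs_less_iff_group by (auto simp: not_less algebra_simps)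
      moreover have "t \<in> {0<..<s}" "t' \<in> {0<..<s}" "t < \<tau>" "t' < \<tau>"
        using x by auto
      ultimately have "\<exists>t\<in>{0<..<s}. \<exists>t'\<in>{0<..<s}. t < \<tau> \<and> t' < \<tau> \<and> f t' x + \<epsilon> \<le> f t x"
        by blast
      moreover have "restrict x {..<m} = x"
        using x(1) assms(2) by (auto simp: PiE_restrict)
      ultimately show ?thesis
        using x(1) by (intro exI[of _ x]) (simp add: P_def upd)
    qed
  qed (use assms(6) in auto)
  then obtain c where c: "\<And>\<tau> \<delta>. 0 < \<tau> \<Longrightarrow> 0 < \<delta> \<Longrightarrow>
      \<exists>x. P (x(m := \<tau>)) \<and> (\<forall>i<m. \<bar>x i - c i\<bar> < \<delta>)" by blast
  \<comment> \<open>The values of \<open>c\<close> from index \<open>m\<close> on are arbitrary; the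
    restriction makes it a point of the space.\<close>
  define z where "z = restrict c {..<m}"
  have "z \<in> C"
  proof (rule closed_set_cluster_point[OF assms(4) _ assms(6)])
    show "\<exists>x\<in>C. \<forall>i<m. \<bar>x i - z i\<bar> < \<delta>" if "0 < \<delta>" for \<delta>
    proof -
      obtain x where "P (x(m := s))" "\<forall>i<m. \<bar>x i - c i\<bar> < \<delta>"
        using c[OF assms(6) \<open>0 < \<delta>\<close>] by blast
      then show ?thesis
        by (intro bexI[of _ "restrict x {..<m}"]) (auto simp: P_def upd z_def)
    qed
  qed (simp add: z_def)
  obtain \<eta> where \<eta>: "0 < \<eta>" "\<eta> + \<eta> + \<eta> \<le> \<epsilon>"
    using exists_third[OF \<open>0 < \<epsilon>\<close>] .
  obtain \<delta> where "0 < \<delta>" and \<delta>: "\<And>t x. t \<in> {0<..<s} \<Longrightarrow> x \<in> C \<Longrightarrow>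
      max_norm m (\<lambda>i. z i - x i) < \<delta> \<Longrightarrow> \<bar>f t z - f t x\<bar> < \<eta>"
    using assms(8) \<eta>(1) \<open>z \<in> C\<close> unfolding equicontinuous_family_def by blast
  obtain s' where "0 < s'" and s': "\<And>t t'. t \<in> {0<..<s'} \<Longrightarrow> t' \<in> {0<..<s'} \<Longrightarrow>
      \<bar>f t z - f t' z\<bar> < \<eta>"
    using assms(9) \<eta>(1) \<open>z \<in> C\<close> unfolding pointwise_convergent_family_def by blast
  \<comment> \<open>Family parameter \<open>s'\<close> puts both indices below \<open>s'\<close>, so
    that pointwise convergence at \<open>z\<close> applies to them.\<close>
  obtain y where y: "P (y(m := s'))" "\<forall>i<m. \<bar>y i - c i\<bar> < \<delta>"
    using c[OF \<open>0 < s'\<close> \<open>0 < \<delta>\<close>] by blast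
  define x where "x = restrict y {..<m}"
  obtain t t' where t: "t \<in> {0<..<s}" "t' \<in> {0<..<s}" "t < s'" "t' < s'"
    and far: "f t' x + \<epsilon> \<le> f t x" and "x \<in> C"
    using y(1) unfolding P_def upd x_def by auto
  have "max_norm m (\<lambda>i. z i - x i) < \<delta>"
    using y(2) \<open>0 < \<delta>\<close> by (auto simp: max_norm_less_iff z_def x_def abs_minus_commute)
  with \<delta> \<open>x \<in> C\<close> t have "\<bar>f t z - f t x\<bar> < \<eta>" "\<bar>f t' z - f t' x\<bar> < \<eta>"
    by blast+
  moreover have "\<bar>f t z - f t' z\<bar> < \<eta>"
    using s' t by simp
  ultimately have "f t x - f t z < \<eta>" "f t z - f t' z < \<eta>" "f t' z - f t' x < \<eta>"
    by (simp_all add: abs_less_iff_group)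
  \<comment> \<open>Passing from \<open>x\<close> to \<open>z\<close> at \<open>t\<close>, from
    \<open>t\<close> to \<open>t'\<close> at \<open>z\<close>, and back to \<open>x\<close> at
    \<open>t'\<close> costs less than \<open>\<eta>\<close> each time.\<close>
  then have "(f t x - f t z) + (f t z - f t' z) + (f t' z - f t' x) < \<eta> + \<eta> + \<eta>"
    by (intro add_strict_mono)
  also have "\<dots> \<le> \<epsilon>" by (rule \<eta>(2))
  finally have "f t x - f t' x < \<epsilon>" by simp
  with far show False by (simp add: algebra_simps)
qed

end
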